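(* Let $(W,S)$ be a Coxeter system of type $\Lambda$ and let $\alpha$ be a reduced expression. Then $\operatorname{diam}(\mathcal{B}(\alpha))\le\dim(\alpha)$.
   Context: A Coxeter system $(W,S)$ consists of a finite set $S$ and the group $W=\langle S\mid (st)^{m(s,t)}=e\rangle$, where $m(s,s)=1$ and $m(s,t)=m(t,s)\in\{2,3,\dots\}\cup\{\infty\}$ for $s\neq t$ ($m(s,t)=\infty$ means no relation). Its Coxeter graph has vertex set $S$ and an edge $\{s,t\}$ whenever $m(s,t)\ge 3$. $(W,S)$ is of type $\Lambda$ if $m(s,t)\le 3$ for all $s,t\in S$ (simply laced) and the Coxeter graph contains no three-cycles (triangle free). A reduced expression for $w\in W$ is a word over $S$ of minimal length representing $w$. A braid move replaces three consecutive letters $sts$ by $tst$, where $m(s,t)=3$. Two reduced expressions are braid equivalent if they are related by a finite sequence of braid moves; $[\alpha]$ denotes the braid class (equivalence class) of $\alpha$. The braid graph $\mathcal{B}(\alpha)$ has vertex set $[\alpha]$, with two vertices adjacent if and only if they are related by a single braid move. A braid shadow for a reduced expression $\alpha$ is a set of positions $\{i-1,i,i+1\}$ such that the letters of $\alpha$ in these positions form $sts$ with $m(s,t)=3$. $\mathcal{S}(\alpha)$ is the set of braid shadows for $\alpha$, and $\mathcal{S}([\alpha])=\bigcup_{\beta\in[\alpha]}\mathcal{S}(\beta)$. The dimension of $\alpha$ is $\dim(\alpha)=|\mathcal{S}([\alpha])|$. The diameter $\operatorname{diam}(G)$ of a finite connected graph is the maximum path distance between two vertices. *)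

theory Defs
  imports
    "HOL-Library.Extended_Nat"
    "Graph_Theory.Pair_Digraph"
    "Graph_Theory.Digraph_Component"
    "Graph_Theory.Shortest_Path"
    "HOL-Algebra.Group"
begin

section \<open>Groups given by generators and relators\<close>

text \<open>A letter \<open>(x, True)\<close> stands for the generator \<open>x\<close>, and \<open>(x, False)\<close> for its formal inverse.\<close>

inductive pres_eq :: "'a set \<Rightarrow> ('a \<times> bool) list set \<Rightarrow> ('a \<times> bool) list \<Rightarrow> ('a \<times> bool) list \<Rightarrow> bool"
  for X R where
  refl: "u \<in> lists (X \<times> UNIV) \<Longrightarrow> pres_eq X R u u"
| sym: "pres_eq X R u v \<Longrightarrow> pres_eq X R v u"
| trans: "pres_eq X R u v \<Longrightarrow> pres_eq X R v w \<Longrightarrow> pres_eq X R u w"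
| cancel: "u \<in> lists (X \<times> UNIV) \<Longrightarrow> v \<in> lists (X \<times> UNIV) \<Longrightarrow> x \<in> X
    \<Longrightarrow> pres_eq X R (u @ [(x, b), (x, \<not> b)] @ v) (u @ v)"
| relator: "u \<in> lists (X \<times> UNIV) \<Longrightarrow> v \<in> lists (X \<times> UNIV) \<Longrightarrow> r \<in> R \<Longrightarrow> r \<in> lists (X \<times> UNIV)
    \<Longrightarrow> pres_eq X R (u @ r @ v) (u @ v)"

definition pres_class :: "'a set \<Rightarrow> ('a \<times> bool) list set \<Rightarrow> ('a \<times> bool) list \<Rightarrow> ('a \<times> bool) list set" where
  "pres_class X R u = {v. pres_eq X R u v}"

definition presented_group :: "'a set \<Rightarrow> ('a \<times> bool) list set \<Rightarrow> ('a \<times> bool) list set monoid" where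
  "presented_group X R =
    \<lparr>carrier = pres_class X R ` lists (X \<times> UNIV),
     mult = (\<lambda>A B. \<Union>a\<in>A. \<Union>b\<in>B. pres_class X R (a @ b)),
     one = pres_class X R []\<rparr>"

lemma pres_eq_in_lists:
  assumes "pres_eq X R u v"
  shows "u \<in> lists (X \<times> UNIV) \<and> v \<in> lists (X \<times> UNIV)"
  using assms by induction auto

lemma pres_eq_append_left:
  assumes "pres_eq X R u v" "w \<in> lists (X \<times> UNIV)"
  shows "pres_eq X R (w @ u) (w @ v)"
  using assms
proof (induction)
  case (cancel u v x b)
  then show ?case using pres_eq.cancel[of "w @ u" X v x R b] by simp
next
  case (relator u v r)
  then show ?case using pres_eq.relator[of "w @ u" X v r R] by simp
next
  case (refl u)
  then show ?case by (simp add: pres_eq.refl)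
next
  case (sym u v)
  show ?case by (rule pres_eq.sym[OF sym.IH[OF sym.prems]])
next
  case (trans u v v')
  show ?case by (rule pres_eq.trans[OF trans.IH(1)[OF trans.prems] trans.IH(2)[OF trans.prems]])
qed

lemma pres_eq_append_right:
  assumes "pres_eq X R u v" "w \<in> lists (X \<times> UNIV)"
  shows "pres_eq X R (u @ w) (v @ w)"
  using assms
proof (induction)
  case (cancel u v x b)
  then show ?case using pres_eq.cancel[of u X "v @ w" x R b] by simp
next
  case (relator u v r)
  then show ?case using pres_eq.relator[of u X "v @ w" r R] by simp
next
  case (refl u)
  then show ?case by (simp add: pres_eq.refl)
next
  case (sym u v)
  show ?case by (rule pres_eq.sym[OF sym.IH[OF sym.prems]])
next
  case (trans u v v')
  show ?case by (rule pres_eq.trans[OF trans.IH(1)[OF trans.prems] trans.IH(2)[OF trans.prems]])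
qed

lemma pres_eq_append:
  assumes "pres_eq X R u u'" "pres_eq X R v v'"
  shows "pres_eq X R (u @ v) (u' @ v')"
proof (rule pres_eq.trans)
  show "pres_eq X R (u @ v) (u' @ v)"
    using assms pres_eq_in_lists[OF assms(2)] by (intro pres_eq_append_right) simp_all
  show "pres_eq X R (u' @ v) (u' @ v')"
    using assms pres_eq_in_lists[OF assms(1)] by (intro pres_eq_append_left) simp_all
qed

lemma pres_class_eq_iff:
  assumes "u \<in> lists (X \<times> UNIV)"
  shows "pres_class X R u = pres_class X R v \<longleftrightarrow> pres_eq X R u v"
proof
  assume "pres_class X R u = pres_class X R v"
  moreover have "u \<in> pres_class X R u" using assms by (simp only: pres_class_def mem_Collect_eq pres_eq.refl)
  ultimately have "pres_eq X R v u" by (simp only: pres_class_def mem_Collect_eq)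
  then show "pres_eq X R u v" by (rule pres_eq.sym)
next
  assume uv: "pres_eq X R u v"
  have "pres_eq X R u w \<longleftrightarrow> pres_eq X R v w" for w
    using pres_eq.trans[OF uv] pres_eq.trans[OF pres_eq.sym[OF uv]] by blast
  then show "pres_class X R u = pres_class X R v" by (simp add: pres_class_def)
qed

lemma mult_pres_class:
  assumes "u \<in> lists (X \<times> UNIV)" "v \<in> lists (X \<times> UNIV)"
  shows "pres_class X R u \<otimes>\<^bsub>presented_group X R\<^esub> pres_class X R v = pres_class X R (u @ v)"
proof -
  have "pres_class X R (a @ b) = pres_class X R (u @ v)"
    if "a \<in> pres_class X R u" "b \<in> pres_class X R v" for a b
  proof -
    have "pres_eq X R (u @ v) (a @ b)"
      using that by (intro pres_eq_append) (simp_all only: pres_class_def mem_Collect_eq)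
    moreover have "u @ v \<in> lists (X \<times> UNIV)" using assms by (simp only: append_in_lists_conv simp_thms)
    ultimately show ?thesis using pres_class_eq_iff by metis
  qed
  moreover have "u \<in> pres_class X R u" "v \<in> pres_class X R v"
    using assms by (simp_all only: pres_class_def mem_Collect_eq pres_eq.refl)
  ultimately have "(\<Union>a\<in>pres_class X R u. \<Union>b\<in>pres_class X R v. pres_class X R (a @ b)) = pres_class X R (u @ v)"
    by blast
  then show ?thesis by (simp only: presented_group_def monoid.simps)
qed

lemma pres_eq_left_inverse:
  assumes "u \<in> lists (X \<times> UNIV)"
  shows "pres_eq X R (rev (map (\<lambda>(x, b). (x, \<not> b)) u) @ u) []"
  using assms
proof (induction u)
  case Nil
  then show ?case by (auto intro: pres_eq.refl)
next
  case (Cons a u)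
  obtain x b where a: "a = (x, b)" by force
  let ?i = "rev (map (\<lambda>(x, b). (x, \<not> b)) u)"
  have i: "?i \<in> lists (X \<times> UNIV)" using Cons.hyps by (auto simp: in_lists_conv_set)
  have "pres_eq X R (?i @ [(x, \<not> b), (x, \<not> \<not> b)] @ u) (?i @ u)"
    using i Cons.hyps a by (intro pres_eq.cancel) auto
  then have "pres_eq X R (rev (map (\<lambda>(x, b). (x, \<not> b)) (a # u)) @ a # u) (?i @ u)"
    using a by simp
  then show ?case by (rule pres_eq.trans[OF _ Cons.IH])
qed

lemma group_presented_group: "group (presented_group X R)"
proof (rule groupI)
  let ?G = "presented_group X R"
  have c: "carrier ?G = pres_class X R ` lists (X \<times> UNIV)"
    and o: "\<one>\<^bsub>?G\<^esub> = pres_class X R []"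
    by (simp_all add: presented_group_def)
  have rep: "\<exists>u\<in>lists (X \<times> UNIV). x = pres_class X R u" if "x \<in> carrier ?G" for x
    using that unfolding c by blast
  show "x \<otimes>\<^bsub>?G\<^esub> y \<in> carrier ?G" if x: "x \<in> carrier ?G" and y: "y \<in> carrier ?G" for x y
  proof -
    obtain u v where "u \<in> lists (X \<times> UNIV)" "v \<in> lists (X \<times> UNIV)"
      and "x = pres_class X R u" "y = pres_class X R v"
      using rep[OF x] rep[OF y] by blast
    then show ?thesis unfolding c
      by (simp only: mult_pres_class append_in_lists_conv image_eqI)
  qed
  show "\<one>\<^bsub>?G\<^esub> \<in> carrier ?G" unfolding c o by blast
  show "x \<otimes>\<^bsub>?G\<^esub> y \<otimes>\<^bsub>?G\<^esub> z = x \<otimes>\<^bsub>?G\<^esub> (y \<otimes>\<^bsub>?G\<^esub> z)"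
    if x: "x \<in> carrier ?G" and y: "y \<in> carrier ?G" and z: "z \<in> carrier ?G" for x y z
  proof -
    obtain u v w where "u \<in> lists (X \<times> UNIV)" "v \<in> lists (X \<times> UNIV)" "w \<in> lists (X \<times> UNIV)"
      and "x = pres_class X R u" "y = pres_class X R v" "z = pres_class X R w"
      using rep[OF x] rep[OF y] rep[OF z] by blast
    then show ?thesis by (simp only: mult_pres_class append_in_lists_conv append_assoc simp_thms)
  qed
  show "\<one>\<^bsub>?G\<^esub> \<otimes>\<^bsub>?G\<^esub> x = x" if "x \<in> carrier ?G" for x
  proof -
    obtain u where u: "u \<in> lists (X \<times> UNIV)" "x = pres_class X R u" using rep[OF \<open>x \<in> carrier ?G\<close>] by blast
    show ?thesis unfolding o u(2) mult_pres_class[OF lists.Nil u(1)] append_Nil ..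
  qed
  show "\<exists>y\<in>carrier ?G. y \<otimes>\<^bsub>?G\<^esub> x = \<one>\<^bsub>?G\<^esub>" if x: "x \<in> carrier ?G" for x
  proof -
    obtain u where u: "u \<in> lists (X \<times> UNIV)" "x = pres_class X R u" using x unfolding c by blast
    let ?i = "rev (map (\<lambda>(x, b). (x, \<not> b)) u)"
    have i: "?i \<in> lists (X \<times> UNIV)" using u(1) by (auto simp: in_lists_conv_set)
    have "pres_class X R ?i \<otimes>\<^bsub>?G\<^esub> x = \<one>\<^bsub>?G\<^esub>"
      unfolding o u(2) mult_pres_class[OF i u(1)]
      by (rule pres_class_eq_iff[THEN iffD2, OF _ pres_eq_left_inverse[OF u(1)]])
        (use i u(1) in \<open>simp only: append_in_lists_conv simp_thms\<close>)
    moreover have "pres_class X R ?i \<in> carrier ?G" unfolding c using i by (rule imageI)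
    ultimately show ?thesis by (rule bexI)
  qed
qed


section \<open>Coxeter systems\<close>

text \<open>A Coxeter system is given by its generating set and its matrix; \<open>\<infinity>\<close> means no relation.
  The values of the matrix outside the generating set play no role.\<close>

definition coxeter_matrix :: "'a set \<Rightarrow> ('a \<Rightarrow> 'a \<Rightarrow> enat) \<Rightarrow> bool" where
  "coxeter_matrix S m \<longleftrightarrow> finite S \<and> (\<forall>s\<in>S. m s s = 1) \<and>
     (\<forall>s\<in>S. \<forall>t\<in>S. s \<noteq> t \<longrightarrow> m s t = m t s \<and> 2 \<le> m s t)"

definition coxeter_relators :: "'a set \<Rightarrow> ('a \<Rightarrow> 'a \<Rightarrow> enat) \<Rightarrow> ('a \<times> bool) list set" where
  "coxeter_relators S m =
     {concat (replicate k [(s, True), (t, True)]) | s t k. s \<in> S \<and> t \<in> S \<and> m s t = enat k}"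

definition coxeter_group :: "'a set \<Rightarrow> ('a \<Rightarrow> 'a \<Rightarrow> enat) \<Rightarrow> ('a \<times> bool) list set monoid" where
  "coxeter_group S m = presented_group S (coxeter_relators S m)"

definition coxeter_gen :: "'a set \<Rightarrow> ('a \<Rightarrow> 'a \<Rightarrow> enat) \<Rightarrow> 'a \<Rightarrow> ('a \<times> bool) list set" where
  "coxeter_gen S m s = pres_class S (coxeter_relators S m) [(s, True)]"

definition word_product :: "'a set \<Rightarrow> ('a \<Rightarrow> 'a \<Rightarrow> enat) \<Rightarrow> 'a list \<Rightarrow> ('a \<times> bool) list set" where
  "word_product S m w =
     foldr (mult (coxeter_group S m)) (map (coxeter_gen S m) w) \<one>\<^bsub>coxeter_group S m\<^esub>"

lemma word_product_eq_pres_class: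
  assumes "w \<in> lists S"
  shows "word_product S m w = pres_class S (coxeter_relators S m) (map (\<lambda>s. (s, True)) w)"
  using assms
proof (induction w)
  case Nil
  then show ?case by (simp add: word_product_def coxeter_group_def presented_group_def)
next
  case (Cons a w)
  let ?w = "map (\<lambda>s. (s, True)) w"
  have l: "?w \<in> lists (S \<times> UNIV)" "[(a, True)] \<in> lists (S \<times> UNIV)"
    using Cons.hyps by (auto simp: in_lists_conv_set)
  have "word_product S m (a # w) = coxeter_gen S m a \<otimes>\<^bsub>coxeter_group S m\<^esub> word_product S m w"
    by (simp add: word_product_def)
  also have "\<dots> = pres_class S (coxeter_relators S m) ([(a, True)] @ ?w)"
    unfolding Cons.IH coxeter_gen_def coxeter_group_def by (rule mult_pres_class[OF l(2,1)])
  finally show ?case by simp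
qed

definition coxeter_graph :: "'a set \<Rightarrow> ('a \<Rightarrow> 'a \<Rightarrow> enat) \<Rightarrow> 'a pair_pre_digraph" where
  "coxeter_graph S m = \<lparr>pverts = S, parcs = {(s, t). s \<in> S \<and> t \<in> S \<and> 3 \<le> m s t}\<rparr>"

definition type_Lambda :: "'a set \<Rightarrow> ('a \<Rightarrow> 'a \<Rightarrow> enat) \<Rightarrow> bool" where
  "type_Lambda S m \<longleftrightarrow> (\<forall>s\<in>S. \<forall>t\<in>S. m s t \<le> 3) \<and>
     \<not> (\<exists>p. pre_digraph.cycle (with_proj (coxeter_graph S m)) p \<and> length p = 3)"

lemma type_Lambda_iff:
  assumes "coxeter_matrix S m"
  shows "type_Lambda S m \<longleftrightarrow> (\<forall>s\<in>S. \<forall>t\<in>S. m s t \<le> 3) \<and>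
    \<not> (\<exists>s\<in>S. \<exists>t\<in>S. \<exists>u\<in>S. m s t \<ge> 3 \<and> m t u \<ge> 3 \<and> m u s \<ge> 3)"
proof -
  interpret pair_pre_digraph "coxeter_graph S m" .
  have ne: "s \<noteq> t" if "s \<in> S" "3 \<le> m s t" for s t
  proof
    assume "s = t"
    then have "(3::enat) \<le> 1" using that assms by (auto simp: coxeter_matrix_def)
    then show False by simp
  qed
  have "(\<exists>p. cycle p \<and> length p = 3) \<longleftrightarrow>
    (\<exists>s\<in>S. \<exists>t\<in>S. \<exists>u\<in>S. m s t \<ge> 3 \<and> m t u \<ge> 3 \<and> m u s \<ge> 3)" (is "?L \<longleftrightarrow> ?R")
  proof
    assume ?L
    then obtain p v where p: "awalk v p v" "length p = 3" unfolding cycle_def by blast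
    then obtain a b c where "p = [a, b, c]" by (auto simp: numeral_3_eq_3 length_Suc_conv)
    then have "set [a, b, c] \<subseteq> parcs (coxeter_graph S m) \<and> pcas v [a, b, c] v"
      using p by (simp add: awalk_def)
    then show ?R by (cases a; cases b; cases c) (auto simp: coxeter_graph_def)
  next
    assume ?R
    then obtain s t u where stu: "s \<in> S" "t \<in> S" "u \<in> S" "m s t \<ge> 3" "m t u \<ge> 3" "m u s \<ge> 3"
      by blast
    then have "s \<in> pverts (coxeter_graph S m)"
      "set [(s, t), (t, u), (u, s)] \<subseteq> parcs (coxeter_graph S m)"
      by (simp_all add: coxeter_graph_def)
    then have "awalk s [(s, t), (t, u), (u, s)] s" by (simp add: awalk_def)
    moreover have "distinct [t, u, s]" using stu ne[of s t] ne[of t u] ne[of u s] by auto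
    ultimately have "cycle [(s, t), (t, u), (u, s)]" by (auto simp: cycle_def)
    then show ?L by (intro exI[of _ "[(s, t), (t, u), (u, s)]"]) simp
  qed
  then show ?thesis unfolding type_Lambda_def by simp
qed

definition reduced :: "'a set \<Rightarrow> ('a \<Rightarrow> 'a \<Rightarrow> enat) \<Rightarrow> 'a list \<Rightarrow> bool" where
  "reduced S m \<alpha> \<longleftrightarrow> \<alpha> \<in> lists S \<and>
     (\<forall>\<beta>\<in>lists S. word_product S m \<beta> = word_product S m \<alpha> \<longrightarrow> length \<alpha> \<le> length \<beta>)"


section \<open>Braid classes, braid graphs and braid shadows\<close>

definition braid_move :: "'a set \<Rightarrow> ('a \<Rightarrow> 'a \<Rightarrow> enat) \<Rightarrow> 'a list \<Rightarrow> 'a list \<Rightarrow> bool" where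
  "braid_move S m \<alpha> \<beta> \<longleftrightarrow> (\<exists>u v s t. s \<in> S \<and> t \<in> S \<and> m s t = 3 \<and>
     \<alpha> = u @ [s, t, s] @ v \<and> \<beta> = u @ [t, s, t] @ v)"

definition braid_class :: "'a set \<Rightarrow> ('a \<Rightarrow> 'a \<Rightarrow> enat) \<Rightarrow> 'a list \<Rightarrow> 'a list set" where
  "braid_class S m \<alpha> = {\<beta>. reduced S m \<beta> \<and> (braid_move S m)\<^sup>*\<^sup>* \<alpha> \<beta>}"

text \<open>An undirected graph is modelled as a symmetric digraph.\<close>

definition braid_graph :: "'a set \<Rightarrow> ('a \<Rightarrow> 'a \<Rightarrow> enat) \<Rightarrow> 'a list \<Rightarrow> 'a list pair_pre_digraph" where
  "braid_graph S m \<alpha> = \<lparr>pverts = braid_class S m \<alpha>,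
     parcs = {(\<beta>, \<gamma>). \<beta> \<in> braid_class S m \<alpha> \<and> \<gamma> \<in> braid_class S m \<alpha> \<and> braid_move S m \<beta> \<gamma>}\<rparr>"

text \<open>Positions in a word are counted from 0.\<close>

definition braid_shadows :: "('a \<Rightarrow> 'a \<Rightarrow> enat) \<Rightarrow> 'a list \<Rightarrow> nat set set" where
  "braid_shadows m \<alpha> = {{i - 1, i, i + 1} | i. 1 \<le> i \<and> i + 1 < length \<alpha> \<and>
     (\<exists>s t. m s t = 3 \<and> \<alpha> ! (i - 1) = s \<and> \<alpha> ! i = t \<and> \<alpha> ! (i + 1) = s)}"

definition class_shadows :: "'a set \<Rightarrow> ('a \<Rightarrow> 'a \<Rightarrow> enat) \<Rightarrow> 'a list \<Rightarrow> nat set set" where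
  "class_shadows S m \<alpha> = (\<Union>\<beta>\<in>braid_class S m \<alpha>. braid_shadows m \<beta>)"

definition braid_dim :: "'a set \<Rightarrow> ('a \<Rightarrow> 'a \<Rightarrow> enat) \<Rightarrow> 'a list \<Rightarrow> nat" where
  "braid_dim S m \<alpha> = card (class_shadows S m \<alpha>)"

text \<open>The path distance is \<open>\<mu>\<close> with all arcs of weight 1. On a finite nonempty
  graph the supremum is a maximum; it is infinite if some vertex does not reach another.\<close>

definition graph_diameter :: "('a, 'b) pre_digraph \<Rightarrow> ereal" where
  "graph_diameter G = (SUP (u, v)\<in>verts G \<times> verts G. wf_digraph.\<mu> G (\<lambda>_. 1) u v)"

lemma graph_diameter_eq_Max:
  assumes "finite (verts G)" "verts G \<noteq> {}"
  shows "graph_diameter G = Max ((\<lambda>(u, v). wf_digraph.\<mu> G (\<lambda>_. 1) u v) ` (verts G \<times> verts G))"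
  using assms unfolding graph_diameter_def by (subst Max_Sup) auto

lemma length_braid_move: "braid_move S m \<alpha> \<beta> \<Longrightarrow> length \<beta> = length \<alpha>"
  by (auto simp: braid_move_def)

lemma length_braid_class:
  assumes "\<beta> \<in> braid_class S m \<alpha>"
  shows "length \<beta> = length \<alpha>"
proof -
  have "(braid_move S m)\<^sup>*\<^sup>* \<alpha> \<beta>" using assms by (simp add: braid_class_def)
  then show ?thesis by induction (auto dest: length_braid_move)
qed

lemma finite_braid_class:
  assumes "finite S"
  shows "finite (braid_class S m \<alpha>)"
proof (rule finite_subset)
  show "braid_class S m \<alpha> \<subseteq> {\<beta>. set \<beta> \<subseteq> S \<and> length \<beta> = length \<alpha>}"
    by (auto simp: length_braid_class) (auto simp: braid_class_def reduced_def)
  show "finite {\<beta>. set \<beta> \<subseteq> S \<and> length \<beta> = length \<alpha>}"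
    using assms by (rule finite_lists_length_eq)
qed

lemma finite_class_shadows: "finite (class_shadows S m \<alpha>)"
proof (rule finite_subset)
  show "class_shadows S m \<alpha> \<subseteq> Pow {..<length \<alpha>}"
    by (auto simp: class_shadows_def braid_shadows_def dest: length_braid_class)
qed simp

lemma pair_graph_braid_graph:
  assumes "coxeter_matrix S m"
  shows "pair_graph (braid_graph S m \<alpha>)"
proof -
  have fin: "finite (braid_class S m \<alpha>)"
    using assms by (intro finite_braid_class) (simp add: coxeter_matrix_def)
  have sub: "parcs (braid_graph S m \<alpha>) \<subseteq> braid_class S m \<alpha> \<times> braid_class S m \<alpha>"
    by (auto simp: braid_graph_def)
  have irr: "\<not> braid_move S m \<beta> \<beta>" for \<beta>
  proof
    assume "braid_move S m \<beta> \<beta>"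
    then obtain s where "s \<in> S" "m s s = 3" by (auto simp: braid_move_def)
    then show False using assms by (auto simp: coxeter_matrix_def)
  qed
  have sym: "braid_move S m \<gamma> \<beta>" if move: "braid_move S m \<beta> \<gamma>" for \<beta> \<gamma>
  proof -
    obtain u v s t where b: "s \<in> S" "t \<in> S" "m s t = 3"
      "\<beta> = u @ [s, t, s] @ v" "\<gamma> = u @ [t, s, t] @ v"
      using move unfolding braid_move_def by blast
    then have "m t s = 3" using assms unfolding coxeter_matrix_def by metis
    then show ?thesis using b unfolding braid_move_def by blast
  qed
  show ?thesis
  proof
    show "finite (parcs (braid_graph S m \<alpha>))"
      using finite_subset[OF sub] fin by simp
    show "symmetric (with_proj (braid_graph S m \<alpha>))"
      using sym by (auto simp: symmetric_def sym_def braid_graph_def)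
  qed (use fin irr in \<open>auto simp: braid_graph_def\<close>)
qed

end

theory Submission
  imports Defs
begin

text \<open>
  Two words of a braid class are joined by a sequence of braid moves, and a braid move is
  determined by the position at which it is performed. The theorem holds because a shortest such
  sequence never uses a position twice: its length is then the number of distinct braid shadows
  that it visits, which is at most the dimension.

  The argument rests on the rigidity of braid shadows inside a braid class. First, two braid
  shadows of a class never have neighbouring centres, so they share at most one position
  (\<open>braid_positions_not_adjacent\<close>). If a word had the shadow \<open>aba\<close> and a word reached from it by a
  shortest possible sequence of moves had the shadow \<open>bab\<close> one place further right, then each of
  the moves in between would lie in the left part or in the right part of the word without touching
  the two middle letters. The moves on the right could be performed alone, and would produce the
  factor \<open>abab\<close>, which is not reduced.

  Second, suppose that a shortest sequence repeats a position and take a repetition with pairwise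
  distinct moves in between (\<open>braid_walk_shorten\<close>). The shadow is \<open>aba\<close> after the first of the two
  moves. Its middle letter \<open>b\<close> is inert in between, and an end letter can change only through the
  shadow that shares this end. This shadow is used at most once, so it would turn the end letter
  from \<open>a\<close> into some \<open>d\<close> joined to \<open>a\<close>, for good. The second move then needs \<open>d\<close> to be joined
  to \<open>b\<close> as well, and \<open>a\<close>, \<open>b\<close>, \<open>d\<close> form a triangle of the Coxeter graph. Hence all moves in
  between are disjoint from the shadow and commute with the two moves, which therefore cancel each
  other.
\<close>

section \<open>Braid moves at positions of a word\<close>

definition flip :: "'a list \<Rightarrow> nat \<Rightarrow> 'a list" where
  "flip w p = w[p := w ! (p + 1), p + 1 := w ! p, p + 2 := w ! (p + 1)]"

lemma length_flip [simp]: "length (flip w p) = length w"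
  by (simp add: flip_def)

lemma nth_flip:
  assumes "p + 2 < length w"
  shows "flip w p ! i = (if i = p \<or> i = p + 2 then w ! (p + 1) else if i = p + 1 then w ! p else w ! i)"
  using assms by (auto simp: flip_def nth_list_update)

definition braid_at :: "('a \<Rightarrow> 'a \<Rightarrow> enat) \<Rightarrow> 'a list \<Rightarrow> nat \<Rightarrow> bool" where
  "braid_at m w p \<longleftrightarrow> p + 2 < length w \<and> w ! (p + 2) = w ! p \<and> m (w ! p) (w ! (p + 1)) = 3"

text \<open>A shadow is recorded here by its leftmost position instead of its centre.\<close>

lemma braid_shadows_eq: "braid_shadows m w = (\<lambda>p. {p, p + 1, p + 2}) ` {p. braid_at m w p}"
proof (intro equalityI subsetI)
  fix A assume "A \<in> braid_shadows m w"
  then obtain i where i: "A = {i - 1, i, i + 1}" "1 \<le> i" "i + 1 < length w"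
    "m (w ! (i - 1)) (w ! i) = 3" "w ! (i + 1) = w ! (i - 1)"
    by (auto simp: braid_shadows_def)
  obtain p where "i = p + 1" using i(2) by (metis le_add_diff_inverse2)
  with i show "A \<in> (\<lambda>p. {p, p + 1, p + 2}) ` {p. braid_at m w p}"
    by (auto simp: braid_at_def)
next
  fix A assume "A \<in> (\<lambda>p. {p, p + 1, p + 2}) ` {p. braid_at m w p}"
  then obtain p where "A = {p, p + 1, p + 2}" "braid_at m w p" by blast
  then show "A \<in> braid_shadows m w"
    by (auto simp: braid_shadows_def braid_at_def intro!: exI[of _ "p + 1"])
qed

lemma inj_shadow: "inj (\<lambda>p::nat. {p, p + 1, p + 2})"
proof (rule injI)
  fix p q :: nat assume *: "{p, p + 1, p + 2} = {q, q + 1, q + 2}"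
  then have "p \<in> {q, q + 1, q + 2}" "q \<in> {p, p + 1, p + 2}" by blast+
  then show "p = q" by auto
qed

lemma nth_flip_other: "\<not> (p \<le> i \<and> i \<le> p + 2) \<Longrightarrow> flip w p ! i = w ! i"
  by (auto simp: flip_def)

lemma flip_flip: "braid_at m w p \<Longrightarrow> flip (flip w p) p = w"
  by (rule nth_equalityI) (auto simp: braid_at_def nth_flip)

lemma flip_commute:
  assumes "p + 2 < q \<or> q + 2 < p"
  shows "flip (flip w p) q = flip (flip w q) p"
proof (rule nth_equalityI)
  fix i assume i: "i < length (flip (flip w p) q)"
  have nth: "flip v r ! i = (if i = r \<or> i = r + 2 then v ! (r + 1) else if i = r + 1 then v ! r else v ! i)"
    if "length v = length w" for v :: "'a list" and r
    using i that by (auto simp: flip_def nth_list_update)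
  have "flip w p ! q = w ! q" "flip w p ! (q + 1) = w ! (q + 1)"
    "flip w q ! p = w ! p" "flip w q ! (p + 1) = w ! (p + 1)"
    using assms by (auto intro!: nth_flip_other)
  then show "flip (flip w p) q ! i = flip (flip w q) p ! i"
    using assms nth by auto
qed simp

lemma braid_at_flip_far:
  assumes "p + 2 < q \<or> q + 2 < p"
  shows "braid_at m (flip w p) q = braid_at m w q"
  using assms by (auto simp: braid_at_def nth_flip_other)

lemma flip_append: "flip (x @ [a, b, c] @ y) (length x) = x @ [b, a, b] @ y"
  by (simp add: flip_def nth_append list_update_append)

lemma braid_at_split:
  assumes "braid_at m w p"
  shows "w = take p w @ [w ! p, w ! (p + 1), w ! p] @ drop (p + 3) w"
    and "flip w p = take p w @ [w ! (p + 1), w ! p, w ! (p + 1)] @ drop (p + 3) w"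
proof -
  have p: "p + 2 < length w" "w ! (p + 2) = w ! p" using assms by (auto simp: braid_at_def)
  then have "drop p w = w ! p # w ! (p + 1) # w ! (p + 2) # drop (p + 3) w"
    using Cons_nth_drop_Suc[of p w] Cons_nth_drop_Suc[of "p + 1" w] Cons_nth_drop_Suc[of "p + 2" w]
    by (simp add: eval_nat_numeral)
  then have "take p w @ drop p w = take p w @ [w ! p, w ! (p + 1), w ! p] @ drop (p + 3) w"
    unfolding p(2) by simp
  then show w: "w = take p w @ [w ! p, w ! (p + 1), w ! p] @ drop (p + 3) w"
    by (simp only: append_take_drop_id)
  have "length (take p w) = p" using p by simp
  then have "flip (take p w @ [w ! p, w ! (p + 1), w ! p] @ drop (p + 3) w) p =
      take p w @ [w ! (p + 1), w ! p, w ! (p + 1)] @ drop (p + 3) w"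
    using flip_append[of "take p w" "w ! p" "w ! (p + 1)" "w ! p" "drop (p + 3) w"] by (simp only:)
  then show "flip w p = take p w @ [w ! (p + 1), w ! p, w ! (p + 1)] @ drop (p + 3) w"
    by (simp only: w[symmetric])
qed

section \<open>Sequences of braid moves\<close>

text \<open>A walk in the braid graph is recorded by the positions of its moves, since the questions
  of which moves repeat and which moves commute are questions about positions.\<close>

fun braid_walk :: "('a \<Rightarrow> 'a \<Rightarrow> enat) \<Rightarrow> 'a list \<Rightarrow> nat list \<Rightarrow> 'a list \<Rightarrow> bool" where
  "braid_walk m w [] v \<longleftrightarrow> v = w"
| "braid_walk m w (p # ps) v \<longleftrightarrow> braid_at m w p \<and> braid_walk m (flip w p) ps v"

lemma braid_walk_append:
  "braid_walk m w (ps @ qs) v \<longleftrightarrow> (\<exists>u. braid_walk m w ps u \<and> braid_walk m u qs v)"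
  by (induction ps arbitrary: w) auto

lemma length_braid_walk: "braid_walk m w ps v \<Longrightarrow> length v = length w"
  by (induction ps arbitrary: w) auto

lemma nth_braid_walk:
  assumes "braid_walk m w ps v" "\<And>p. p \<in> set ps \<Longrightarrow> \<not> (p \<le> i \<and> i \<le> p + 2)"
  shows "v ! i = w ! i"
  using assms
proof (induction ps arbitrary: w)
  case (Cons p ps)
  then have "v ! i = flip w p ! i" by (simp del: not_le)
  also have "\<dots> = w ! i" using Cons.prems(2)[of p] by (intro nth_flip_other) simp
  finally show ?case .
qed simp

text \<open>Moves on the two sides of a cut before position \<open>k\<close> do not see each other, so those on the
  right can be performed alone. The start word is allowed to differ to the left of the cut: this is
  what remains in the induction once a left move has been skipped.\<close>

lemma braid_walk_right_part:
  assumes "braid_walk m w ps v" "\<And>p. p \<in> set ps \<Longrightarrow> p + 2 < k \<or> k \<le> p"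
    and "length w' = length w" "\<And>i. k \<le> i \<Longrightarrow> w' ! i = w ! i"
  shows "\<exists>v'. braid_walk m w' (filter (\<lambda>p. k \<le> p) ps) v' \<and> (\<forall>i\<ge>k. v' ! i = v ! i)"
  using assms
proof (induction ps arbitrary: w w')
  case (Cons p ps)
  have w: "braid_at m w p" "braid_walk m (flip w p) ps v" using Cons.prems(1) by simp_all
  then have p: "p + 2 < length w" by (simp add: braid_at_def)
  show ?case
  proof (cases "k \<le> p")
    case True
    have "braid_at m w' p" using w(1) Cons.prems(3,4) True by (simp add: braid_at_def)
    moreover have "flip w' p ! i = flip w p ! i" if "k \<le> i" for i
      using True Cons.prems(3,4) that p by (simp add: nth_flip)
    then have "\<exists>v'. braid_walk m (flip w' p) (filter (\<lambda>p. k \<le> p) ps) v' \<and> (\<forall>i\<ge>k. v' ! i = v ! i)"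
      using Cons.prems(2,3) by (intro Cons.IH[OF w(2)]) simp_all
    ultimately show ?thesis using True by simp
  next
    case False
    then have "p + 2 < k" using Cons.prems(2)[of p] by simp
    then have "w' ! i = flip w p ! i" if "k \<le> i" for i
      using Cons.prems(4)[OF that] that by (simp add: nth_flip_other)
    then have "\<exists>v'. braid_walk m w' (filter (\<lambda>p. k \<le> p) ps) v' \<and> (\<forall>i\<ge>k. v' ! i = v ! i)"
      using Cons.prems(2,3) by (intro Cons.IH[OF w(2)]) simp_all
    then show ?thesis using False by simp
  qed
qed simp

lemma braid_walk_commute_flip:
  assumes "braid_walk m w ps v" "\<And>p. p \<in> set ps \<Longrightarrow> p + 2 < c \<or> c + 2 < p"
  shows "braid_walk m (flip w c) ps (flip v c)"
  using assms
proof (induction ps arbitrary: w)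
  case (Cons p ps)
  have far: "p + 2 < c \<or> c + 2 < p" using Cons.prems(2) by simp
  have "braid_walk m (flip (flip w p) c) ps (flip v c)"
    using Cons.prems by (intro Cons.IH) simp_all
  moreover have "flip (flip w p) c = flip (flip w c) p" using far by (rule flip_commute)
  moreover have "braid_at m (flip w c) p" using Cons.prems(1) far braid_at_flip_far[of c p m w] by auto
  ultimately show ?case by simp
qed simp

text \<open>The first repetition encountered when reading from the left has no other repetition inside it.\<close>

lemma not_distinct_first_repetition:
  assumes "\<not> distinct xs"
  shows "\<exists>us c vs ws. xs = us @ c # vs @ c # ws \<and> distinct (c # vs)"
  using assms
proof (induction xs rule: rev_induct)
  case (snoc x xs)
  show ?case
  proof (cases "distinct xs")
    case True
    with snoc.prems have "x \<in> set xs" by simp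
    then obtain us vs where "xs = us @ x # vs" by (meson split_list)
    with True show ?thesis by (intro exI[of _ us] exI[of _ x] exI[of _ vs] exI[of _ "[]"]) simp
  next
    case False
    with snoc.IH obtain us c vs ws where "xs = us @ c # vs @ c # ws" "distinct (c # vs)" by blast
    then show ?thesis by (intro exI[of _ us] exI[of _ c] exI[of _ vs] exI[of _ "ws @ [x]"]) simp
  qed
qed simp

section \<open>Braid moves on reduced words\<close>

locale coxeter_system =
  fixes S :: "'a set" and m :: "'a \<Rightarrow> 'a \<Rightarrow> enat"
  assumes coxeter_matrix: "coxeter_matrix S m"
begin

lemma m_commute: "s \<in> S \<Longrightarrow> t \<in> S \<Longrightarrow> m s t = m t s"
  using coxeter_matrix unfolding coxeter_matrix_def by metis

lemma m_self: "s \<in> S \<Longrightarrow> m s s = 1"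
  using coxeter_matrix unfolding coxeter_matrix_def by metis

abbreviation word_eq :: "'a list \<Rightarrow> 'a list \<Rightarrow> bool" where
  "word_eq u v \<equiv> pres_eq S (coxeter_relators S m) (map (\<lambda>s. (s, True)) u) (map (\<lambda>s. (s, True)) v)"

lemma positive_word_in_lists: "map (\<lambda>s. (s, True)) u \<in> lists (S \<times> UNIV) \<longleftrightarrow> u \<in> lists S"
  by (auto simp: in_lists_conv_set)

lemma word_product_eq_iff:
  assumes "u \<in> lists S" "v \<in> lists S"
  shows "word_product S m u = word_product S m v \<longleftrightarrow> word_eq u v"
  by (simp only: word_product_eq_pres_class[OF assms(1)] word_product_eq_pres_class[OF assms(2)]
      pres_class_eq_iff[OF positive_word_in_lists[THEN iffD2, OF assms(1)]])

lemma word_eq_relator: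
  assumes "u \<in> lists S" "v \<in> lists S" "s \<in> S" "t \<in> S" "m s t = enat k"
  shows "word_eq (u @ concat (replicate k [s, t]) @ v) (u @ v)"
proof -
  have 1: "map (\<lambda>s. (s, True)) (concat (replicate k [s, t])) = concat (replicate k [(s, True), (t, True)])"
    by (simp add: map_concat)
  have 2: "concat (replicate k [s, t]) \<in> lists S" using assms(3,4) by (induction k) auto
  show ?thesis unfolding map_append
    by (rule pres_eq.relator)
       (use assms 2 in \<open>simp_all only: positive_word_in_lists\<close>, use assms in \<open>auto simp: 1 coxeter_relators_def\<close>)
qed

lemma word_eq_square:
  assumes "u \<in> lists S" "v \<in> lists S" "s \<in> S"
  shows "word_eq (u @ [s, s] @ v) (u @ v)"
  using word_eq_relator[OF assms(1,2,3,3), of 1] m_self[OF assms(3)] by (simp add: one_enat_def)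

text \<open>Both sides are reached from \<open>sts tst tst\<close>: its first six letters are the relator \<open>(st)\<^sup>3\<close>,
  and its last six cancel in pairs.\<close>

lemma word_eq_braid:
  assumes "u \<in> lists S" "v \<in> lists S" "s \<in> S" "t \<in> S" "m s t = 3"
  shows "word_eq (u @ [s, t, s] @ v) (u @ [t, s, t] @ v)"
proof -
  have "word_eq (u @ [s, t, s, t, s, t] @ [t, s, t] @ v) (u @ [t, s, t] @ v)"
    using word_eq_relator[of u "[t, s, t] @ v" s t 3] assms by (simp add: numeral_eq_enat numeral_3_eq_3)
  moreover have "word_eq (u @ [s, t, s, t, s, t] @ [t, s, t] @ v) (u @ [s, t, s, t, s, s, t] @ v)"
    using word_eq_square[of "u @ [s, t, s, t, s]" "[s, t] @ v" t] assms by simp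
  moreover have "word_eq (u @ [s, t, s, t, s, s, t] @ v) (u @ [s, t, s, t, t] @ v)"
    using word_eq_square[of "u @ [s, t, s, t]" "t # v" s] assms by simp
  moreover have "word_eq (u @ [s, t, s, t, t] @ v) (u @ [s, t, s] @ v)"
    using word_eq_square[of "u @ [s, t, s]" v t] assms by simp
  ultimately show ?thesis by (meson pres_eq.sym pres_eq.trans)
qed

lemma reduced_word_eq:
  assumes "reduced S m w" "v \<in> lists S" "word_eq w v"
  shows "length w \<le> length v"
  using assms word_product_eq_iff[of w v] unfolding reduced_def by metis

lemma braid_letters_in_S:
  assumes "w \<in> lists S" "braid_at m w p"
  shows "w ! p \<in> S" "w ! (p + 1) \<in> S"
  using assms by (auto simp: braid_at_def in_lists_conv_set)

lemma braid_at_flip: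
  assumes "w \<in> lists S" "braid_at m w p"
  shows "braid_at m (flip w p) p"
  using assms m_commute[OF braid_letters_in_S[OF assms]] by (auto simp: braid_at_def nth_flip)

lemma reduced_flip:
  assumes "reduced S m w" "braid_at m w p"
  shows "reduced S m (flip w p)"
proof -
  have w: "w \<in> lists S" using assms(1) by (simp add: reduced_def)
  note l = braid_letters_in_S[OF w assms(2)]
  have td: "take p w \<in> lists S" "drop (p + 3) w \<in> lists S"
    using w by (auto simp: in_lists_conv_set dest: in_set_takeD in_set_dropD)
  have "word_eq (take p w @ [w ! p, w ! (p + 1), w ! p] @ drop (p + 3) w)
      (take p w @ [w ! (p + 1), w ! p, w ! (p + 1)] @ drop (p + 3) w)"
    using td l assms(2) by (intro word_eq_braid) (simp_all add: braid_at_def)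
  then have "word_eq w (flip w p)"
    by (simp only: braid_at_split[OF assms(2), symmetric])
  moreover have f: "flip w p \<in> lists S"
    using td l by (subst braid_at_split(2)[OF assms(2)]) simp
  ultimately have "word_product S m (flip w p) = word_product S m w"
    using word_product_eq_iff[OF w f] by simp
  then show ?thesis using assms(1) f by (simp add: reduced_def)
qed

lemma reduced_braid_walk:
  "reduced S m w \<Longrightarrow> braid_walk m w ps v \<Longrightarrow> reduced S m v"
  by (induction ps arbitrary: w) (auto intro: reduced_flip)

lemma braid_move_iff:
  assumes "w \<in> lists S"
  shows "braid_move S m w v \<longleftrightarrow> (\<exists>p. braid_at m w p \<and> v = flip w p)"
proof
  assume "braid_move S m w v"
  then obtain x y s t where *: "m s t = 3" "w = x @ [s, t, s] @ y" "v = x @ [t, s, t] @ y"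
    by (auto simp: braid_move_def)
  then have "braid_at m w (length x)" "v = flip w (length x)"
    by (simp_all add: braid_at_def flip_def nth_append list_update_append)
  then show "\<exists>p. braid_at m w p \<and> v = flip w p" by blast
next
  assume "\<exists>p. braid_at m w p \<and> v = flip w p"
  then obtain p where p: "braid_at m w p" "v = flip w p" by blast
  then have "m (w ! p) (w ! (p + 1)) = 3" by (simp add: braid_at_def)
  then show "braid_move S m w v"
    using braid_at_split[OF p(1)] braid_letters_in_S[OF assms p(1)] p(2)
    unfolding braid_move_def by blast
qed

lemma braid_walk_rev:
  "reduced S m w \<Longrightarrow> braid_walk m w ps v \<Longrightarrow> braid_walk m v (rev ps) w"
proof (induction ps arbitrary: w)
  case (Cons p ps)
  have r: "reduced S m (flip w p)" using Cons.prems by (intro reduced_flip) simp_all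
  then have "braid_walk m v (rev ps) (flip w p)"
    using Cons.prems by (intro Cons.IH) simp_all
  moreover have "braid_at m (flip w p) p" "flip (flip w p) p = w"
    using Cons.prems by (auto simp: reduced_def intro: braid_at_flip flip_flip)
  ultimately show ?case by (auto simp: braid_walk_append)
qed simp

text \<open>Shadows with neighbouring centres in a single word form a factor \<open>abab = babb = ba\<close>.\<close>

lemma not_reduced_alternating:
  assumes "reduced S m w" "braid_at m w p" "braid_at m w (p + 1)"
  shows False
proof -
  let ?a = "w ! p" and ?b = "w ! (p + 1)"
  let ?x = "take p w" and ?y = "drop (p + 4) w"
  have w: "w \<in> lists S" using assms(1) by (simp add: reduced_def)
  note l = braid_letters_in_S[OF w assms(2)]
  have td: "?x \<in> lists S" "?y \<in> lists S"
    using w by (auto simp: in_lists_conv_set dest: in_set_takeD in_set_dropD)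
  have len: "p + 3 < length w" "w ! (p + 3) = ?b"
    using assms(3) by (auto simp: braid_at_def eval_nat_numeral)
  then have "drop (p + 3) w = ?b # ?y"
    using Cons_nth_drop_Suc[of "p + 3" w] by (simp add: eval_nat_numeral)
  then have eq: "w = ?x @ [?a, ?b, ?a] @ ?b # ?y" using braid_at_split(1)[OF assms(2)] by simp
  have "word_eq (?x @ [?a, ?b, ?a] @ ?b # ?y) (?x @ [?b, ?a, ?b] @ ?b # ?y)"
    using td l assms(2) by (intro word_eq_braid) (auto simp: braid_at_def)
  moreover have "word_eq (?x @ [?b, ?a, ?b] @ ?b # ?y) (?x @ [?b, ?a] @ ?y)"
    using word_eq_square[of "?x @ [?b, ?a]" ?y ?b] td l by simp
  ultimately have "word_eq (?x @ [?a, ?b, ?a] @ ?b # ?y) (?x @ [?b, ?a] @ ?y)"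
    by (rule pres_eq.trans)
  then have "word_eq w (?x @ [?b, ?a] @ ?y)" by (simp only: eq[symmetric])
  then have "length w \<le> length (?x @ [?b, ?a] @ ?y)"
    using td l by (intro reduced_word_eq[OF assms(1)]) simp_all
  then show False using len by simp
qed

section \<open>Rigidity of braid shadows in a braid class\<close>

text \<open>Induction on the length of the walk says that every shadow used on the way avoids the
  neighbours of both \<open>i\<close> and \<open>j\<close>, and also \<open>i\<close> and \<open>j\<close> themselves, which neighbour
  each other if the claim fails. What is left are moves well to the left and well to the right.
  Performing only the right ones leaves the shadow at \<open>i\<close> intact and completes the shadow at
  \<open>j\<close> in the same word.\<close>

lemma braid_positions_not_adjacent:
  assumes "reduced S m w" "braid_walk m w ps v" "braid_at m w i" "braid_at m v j"
  shows "j \<noteq> Suc i \<and> i \<noteq> Suc j"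
  using assms
proof (induction "length ps" arbitrary: w ps v i j rule: less_induct)
  case less
  \<comment> \<open>One orientation suffices, since walks of length \<open>length ps\<close> can be reversed.\<close>
  have key: "j \<noteq> Suc i"
    if w: "reduced S m w" and walk: "braid_walk m w qs v" and len: "length qs = length ps"
      and i: "braid_at m w i" and j: "braid_at m v j" for w qs v i j
  proof
    assume ji: "j = Suc i"
    \<comment> \<open>Every move of the walk spares the positions \<open>i + 1\<close> and \<open>i + 2\<close>.\<close>
    have away: "q + 2 < i + 1 \<or> i + 3 \<le> q" if "q \<in> set qs" for q
    proof -
      obtain xs ys where qs: "qs = xs @ q # ys" using \<open>q \<in> set qs\<close> by (meson split_list)
      then obtain u where u: "braid_walk m w xs u" "braid_at m u q" "braid_walk m (flip u q) ys v"
        using walk by (auto simp: braid_walk_append)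
      have ru: "reduced S m u" using reduced_braid_walk[OF w u(1)] .
      have "q \<noteq> Suc i \<and> i \<noteq> Suc q"
        by (rule less.hyps[OF _ w u(1) i u(2)]) (use len qs in simp)
      moreover have "j \<noteq> Suc q \<and> q \<noteq> Suc j"
        by (rule less.hyps[OF _ reduced_flip[OF ru u(2)] u(3) braid_at_flip[OF _ u(2)] j])
          (use len qs ru in \<open>simp_all add: reduced_def\<close>)
      ultimately show ?thesis using ji by linarith
    qed
    have far: "q + 2 < i + 1 \<or> i + 1 \<le> q" if "q \<in> set qs" for q using away[OF that] by linarith
    obtain x where x: "braid_walk m w (filter (\<lambda>p. i + 1 \<le> p) qs) x" "\<forall>l\<ge>i + 1. x ! l = v ! l"
      using braid_walk_right_part[OF walk far] by blast
    have rx: "reduced S m x" using reduced_braid_walk[OF w x(1)] .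
    have xl: "x ! l = w ! l" if "l \<le> i + 2" for l
      using that by (intro nth_braid_walk[OF x(1)]) (use away in fastforce)
    have "length x = length v" "length x = length w"
      using length_braid_walk[OF x(1)] length_braid_walk[OF walk] by simp_all
    moreover have "x ! i = w ! i" "x ! (i + 1) = w ! (i + 1)" "x ! (i + 2) = w ! (i + 2)"
      by (simp_all add: xl)
    moreover have "x ! (i + 1) = v ! (i + 1)" "x ! (i + 1 + 1) = v ! (i + 1 + 1)"
      "x ! (i + 1 + 2) = v ! (i + 1 + 2)"
      by (simp_all add: x(2))
    ultimately have "braid_at m x i" "braid_at m x (i + 1)"
      using i j ji unfolding braid_at_def by (metis, metis Suc_eq_plus1)
    then show False by (rule not_reduced_alternating[OF rx])
  qed
  have "reduced S m v" by (rule reduced_braid_walk[OF less.prems(1,2)])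
  moreover have "braid_walk m v (rev ps) w"
    by (rule braid_walk_rev[OF less.prems(1,2)])
  ultimately show ?case
    using key[OF less.prems(1,2) _ less.prems(3,4)] key[of v "rev ps" w j i] less.prems by simp
qed

section \<open>Shortest sequences of braid moves\<close>

text \<open>The two moves of an innermost repetition cancel, because triangle freeness forbids the moves
  between them to touch the repeated shadow.\<close>

lemma braid_walk_shorten:
  assumes triangle_free: "\<not> (\<exists>s\<in>S. \<exists>t\<in>S. \<exists>u\<in>S. m s t \<ge> 3 \<and> m t u \<ge> 3 \<and> m u s \<ge> 3)"
    and w: "reduced S m w" and walk: "braid_walk m w ps v" and nd: "\<not> distinct ps"
  shows "\<exists>qs. braid_walk m w qs v \<and> length qs < length ps"
proof -
  obtain us c vs ws where ps: "ps = us @ c # vs @ c # ws" and d: "distinct (c # vs)"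
    using not_distinct_first_repetition[OF nd] by blast
  obtain u x where u: "braid_walk m w us u" "braid_at m u c" "braid_walk m (flip u c) vs x"
    and x: "braid_at m x c" "braid_walk m (flip x c) ws v"
    using walk unfolding ps by (auto simp: braid_walk_append)
  define y where "y = flip u c"
  have ru: "reduced S m u" using reduced_braid_walk[OF w u(1)] .
  then have ry: "reduced S m y" using reduced_flip u(2) y_def by blast
  have yS: "y \<in> lists S" using ry by (simp add: reduced_def)
  have yc: "braid_at m y c" using ru u(2) unfolding y_def reduced_def by (blast intro: braid_at_flip)
  have yx: "braid_walk m y vs x" using u(3) y_def by simp
  have xS: "x \<in> lists S" using reduced_braid_walk[OF ry yx] by (simp add: reduced_def)
  have nadj: "q \<noteq> Suc c \<and> c \<noteq> Suc q \<and> q \<noteq> c" if "q \<in> set vs" for q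
  proof -
    obtain xs ys where qs: "vs = xs @ q # ys" using \<open>q \<in> set vs\<close> by (meson split_list)
    then obtain z where "braid_walk m y xs z" "braid_at m z q" using yx by (auto simp: braid_walk_append)
    from braid_positions_not_adjacent[OF ry this(1) yc this(2)] show ?thesis using d that by auto
  qed
  have mid: "x ! (c + 1) = y ! (c + 1)"
    by (rule nth_braid_walk[OF yx]) (use nadj in fastforce)
  \<comment> \<open>\<open>q\<close> is a move whose shadow shares its end \<open>e\<close> with the repeated shadow.\<close>
  have no_triangle: False
    if q: "q \<in> set vs" and e: "e = q \<or> e = q + 2" "e = c \<or> e = c + 2" "q \<noteq> c" for q e
  proof -
    obtain xs ys where qs: "vs = xs @ q # ys" using q by (meson split_list)
    then obtain z where z: "braid_walk m y xs z" "braid_at m z q" "braid_walk m (flip z q) ys x"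
      using yx by (auto simp: braid_walk_append)
    have zS: "z \<in> lists S" using reduced_braid_walk[OF ry z(1)] by (simp add: reduced_def)
    \<comment> \<open>No other move touches \<open>e\<close>: it would neighbour \<open>q\<close> or \<open>c\<close>, or be one of them again.\<close>
    have only: "\<not> (p \<le> e \<and> e \<le> p + 2)" if "p \<in> set xs \<union> set ys" for p
    proof -
      have "p \<in> set vs" "p \<noteq> q" using that d qs by auto
      then show ?thesis using nadj[of p] nadj[OF q] e by auto
    qed
    have ye: "z ! e = y ! e" by (rule nth_braid_walk[OF z(1)]) (use only in blast)
    have xe: "x ! e = flip z q ! e" by (rule nth_braid_walk[OF z(3)]) (use only in blast)
    let ?a = "y ! c" and ?b = "y ! (c + 1)" and ?d = "z ! (q + 1)"
    have ab: "m ?a ?b = 3" "y ! e = ?a" using yc e(2) by (auto simp: braid_at_def)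
    have "z ! q = ?a" using z(2) ye ab(2) e(1) by (auto simp: braid_at_def)
    then have ad: "m ?a ?d = 3" using z(2) by (simp add: braid_at_def)
    have "x ! e = ?d" using xe e(1) z(2) by (auto simp: braid_at_def nth_flip)
    moreover have "x ! e = x ! c" using x(1) e(2) by (auto simp: braid_at_def)
    ultimately have db: "m ?d ?b = 3" using x(1) mid by (simp add: braid_at_def)
    have S: "?a \<in> S" "?b \<in> S" "?d \<in> S"
      using braid_letters_in_S[OF yS yc] braid_letters_in_S[OF zS z(2)] by simp_all
    have "m ?b ?d = 3" "m ?d ?a = 3" using db ad m_commute S by metis+
    with triangle_free ab(1) S show False by (metis order_refl)
  qed
  have far: "q + 2 < c \<or> c + 2 < q" if "q \<in> set vs" for q
    using nadj[OF that] no_triangle[OF that, of q] no_triangle[OF that, of "q + 2"] by force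
  have "flip y c = u" unfolding y_def using u(2) by (rule flip_flip)
  then have "braid_walk m u vs (flip x c)"
    using braid_walk_commute_flip[OF yx far] by simp
  then have "braid_walk m w (us @ vs @ ws) v"
    using u(1) x(2) by (auto simp: braid_walk_append)
  then show ?thesis using ps by (intro exI[of _ "us @ vs @ ws"]) simp
qed

lemma braid_walk_distinct:
  assumes "\<not> (\<exists>s\<in>S. \<exists>t\<in>S. \<exists>u\<in>S. m s t \<ge> 3 \<and> m t u \<ge> 3 \<and> m u s \<ge> 3)"
    and "reduced S m w" "braid_walk m w ps v"
  shows "\<exists>qs. braid_walk m w qs v \<and> distinct qs"
  using assms(3)
proof (induction "length ps" arbitrary: ps rule: less_induct)
  case less
  show ?case
  proof (cases "distinct ps")
    case False
    then obtain qs where "braid_walk m w qs v" "length qs < length ps"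
      using braid_walk_shorten[OF assms(1,2) less.prems] by blast
    then show ?thesis by (rule less.hyps[rotated])
  qed (use less.prems in blast)
qed

section \<open>Braid walks in the braid graph\<close>

lemma braid_class_iff_walk:
  assumes "reduced S m w"
  shows "v \<in> braid_class S m w \<longleftrightarrow> (\<exists>ps. braid_walk m w ps v)"
proof
  assume "v \<in> braid_class S m w"
  then have "(braid_move S m)\<^sup>*\<^sup>* w v" by (simp add: braid_class_def)
  then show "\<exists>ps. braid_walk m w ps v"
  proof induction
    case base
    have "braid_walk m w [] w" by simp
    then show ?case ..
  next
    case (step u v)
    then obtain ps where ps: "braid_walk m w ps u" by blast
    then have "u \<in> lists S" using reduced_braid_walk[OF assms] by (simp add: reduced_def)
    then obtain p where "braid_at m u p" "v = flip u p" using step.hyps braid_move_iff by blast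
    then have "braid_walk m w (ps @ [p]) v" using ps by (auto simp: braid_walk_append)
    then show ?case ..
  qed
next
  assume "\<exists>ps. braid_walk m w ps v"
  then obtain ps where ps: "braid_walk m w ps v" ..
  then have "(braid_move S m)\<^sup>*\<^sup>* w v" using assms
  proof (induction ps arbitrary: w)
    case (Cons p ps)
    then have "braid_move S m w (flip w p)" by (subst braid_move_iff) (auto simp: reduced_def)
    moreover have "(braid_move S m)\<^sup>*\<^sup>* (flip w p) v"
      using Cons.prems by (intro Cons.IH reduced_flip) simp_all
    ultimately show ?case by (rule converse_rtranclp_into_rtranclp)
  qed simp
  then show "v \<in> braid_class S m w" using reduced_braid_walk[OF assms ps] by (simp add: braid_class_def)
qed

lemma braid_walk_imp_awalk:
  assumes "w \<in> braid_class S m \<alpha>" "braid_walk m w ps v"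
  shows "\<exists>es. pre_digraph.awalk (with_proj (braid_graph S m \<alpha>)) w es v \<and> length es = length ps"
proof -
  interpret pair_graph "braid_graph S m \<alpha>" using coxeter_matrix by (rule pair_graph_braid_graph)
  have verts: "pverts (braid_graph S m \<alpha>) = braid_class S m \<alpha>"
    and arcs: "parcs (braid_graph S m \<alpha>) = {(\<beta>, \<gamma>). \<beta> \<in> braid_class S m \<alpha> \<and>
      \<gamma> \<in> braid_class S m \<alpha> \<and> braid_move S m \<beta> \<gamma>}"
    by (simp_all add: braid_graph_def)
  show ?thesis using assms
  proof (induction ps arbitrary: w)
    case Nil
    then have "awalk w [] v" by (simp add: awalk_Nil_iff verts)
    then show ?case by auto
  next
    case (Cons p ps)
    have w: "reduced S m w" "(braid_move S m)\<^sup>*\<^sup>* \<alpha> w"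
      using Cons.prems(1) by (simp_all add: braid_class_def)
    have mv: "braid_move S m w (flip w p)"
      using Cons.prems(2) w(1) braid_move_iff by (auto simp: reduced_def)
    have "reduced S m (flip w p)" using w(1) Cons.prems(2) by (intro reduced_flip) simp_all
    with w mv have fc: "flip w p \<in> braid_class S m \<alpha>"
      by (auto simp: braid_class_def intro: rtranclp.rtrancl_into_rtrancl)
    then obtain es where es: "awalk (flip w p) es v" "length es = length ps"
      using Cons.IH Cons.prems(2) by auto
    then have "awalk w ((w, flip w p) # es) v"
      using Cons.prems(1) fc mv by (simp add: awalk_Cons_iff arcs)
    then show ?case using es(2) by (intro exI[of _ "(w, flip w p) # es"]) simp
  qed
qed

lemma distinct_walk_length_le_dim:
  assumes "reduced S m \<alpha>" "w \<in> braid_class S m \<alpha>" "braid_walk m w ps v" "distinct ps"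
  shows "length ps \<le> braid_dim S m \<alpha>"
proof -
  have "{p, p + 1, p + 2} \<in> class_shadows S m \<alpha>" if "p \<in> set ps" for p
  proof -
    obtain qs where qs: "braid_walk m \<alpha> qs w" using assms(1,2) braid_class_iff_walk by blast
    obtain xs ys where "ps = xs @ p # ys" using \<open>p \<in> set ps\<close> by (meson split_list)
    then obtain u where u: "braid_walk m w xs u" "braid_at m u p"
      using assms(3) by (auto simp: braid_walk_append)
    then have "braid_walk m \<alpha> (qs @ xs) u" using qs by (auto simp: braid_walk_append)
    then have "u \<in> braid_class S m \<alpha>" using assms(1) braid_class_iff_walk by blast
    then show ?thesis using u(2) unfolding class_shadows_def braid_shadows_eq by blast
  qed
  then have "(\<lambda>p. {p, p + 1, p + 2}) ` set ps \<subseteq> class_shadows S m \<alpha>" by blast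
  then have "card ((\<lambda>p. {p, p + 1, p + 2}) ` set ps) \<le> braid_dim S m \<alpha>"
    unfolding braid_dim_def by (intro card_mono finite_class_shadows)
  also have "card ((\<lambda>p. {p, p + 1, p + 2}) ` set ps) = card (set ps)"
    by (rule card_image[OF inj_on_subset[OF inj_shadow subset_UNIV]])
  finally show ?thesis using distinct_card[OF assms(4)] by simp
qed

end

theorem corollary5p5:
  fixes S :: "'a set" and m :: "'a \<Rightarrow> 'a \<Rightarrow> enat" and \<alpha> :: "'a list"
  assumes "coxeter_matrix S m"
    and "type_Lambda S m"
    and "reduced S m \<alpha>"
  shows "graph_diameter (with_proj (braid_graph S m \<alpha>)) \<le> ereal (real (braid_dim S m \<alpha>))"
proof -
  interpret coxeter_system S m using assms(1) by unfold_locales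
  interpret pair_graph "braid_graph S m \<alpha>" using assms(1) by (rule pair_graph_braid_graph)
  have triangle_free: "\<not> (\<exists>s\<in>S. \<exists>t\<in>S. \<exists>u\<in>S. m s t \<ge> 3 \<and> m t u \<ge> 3 \<and> m u s \<ge> 3)"
    using assms(2) type_Lambda_iff[OF assms(1)] by blast
  have "wf_digraph.\<mu> (with_proj (braid_graph S m \<alpha>)) (\<lambda>_. 1) w v \<le> ereal (real (braid_dim S m \<alpha>))"
    if w: "w \<in> braid_class S m \<alpha>" and v: "v \<in> braid_class S m \<alpha>" for w v
  proof -
    have rw: "reduced S m w" using w by (simp add: braid_class_def)
    obtain ps qs where "braid_walk m \<alpha> ps w" "braid_walk m \<alpha> qs v"
      using w v braid_class_iff_walk[OF assms(3)] by blast
    then have "braid_walk m w (rev ps @ qs) v"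
      using braid_walk_rev[OF assms(3)] by (auto simp: braid_walk_append)
    then obtain rs where rs: "braid_walk m w rs v" "distinct rs"
      using braid_walk_distinct[OF triangle_free rw] by blast
    obtain es where es: "awalk w es v" "length es = length rs"
      using braid_walk_imp_awalk[OF w rs(1)] by blast
    have "\<mu> (\<lambda>_. 1) w v \<le> ereal (awalk_cost (\<lambda>_. 1) es)" by (rule min_cost_le_walk_cost[OF es(1)])
    also have "awalk_cost (\<lambda>_. 1) es = real (length rs)"
      unfolding es(2)[symmetric] by (induction es) simp_all
    also have "ereal (real (length rs)) \<le> ereal (real (braid_dim S m \<alpha>))"
      using distinct_walk_length_le_dim[OF assms(3) w rs] by simp
    finally show ?thesis .
  qed
  then show ?thesis unfolding graph_diameter_def by (auto intro!: SUP_least simp: braid_graph_def)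
qed

end
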